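(* Let $(\mathbb A,\mathbb B)$ be a PCSP template, let $\mathcal R$ be a relaxation (i.e. a minion) that does not accept all instances, i.e. not every LC instance has a solution in $\mathcal R$, let $\mathcal I$ be an instance of $\mathrm{PCSP}(\mathbb A,\mathbb B)$, and let $k\in\mathbb N$. (1) If $\mathrm{lc}_{\mathbb A}^{nk}(\mathcal I)$ has a solution in $\mathcal R$, then so does $\mathrm{pow}_k\,\mathrm{lc}_{\mathbb A}(\mathcal I)$, where $n$ is the maximal arity of the relations in $\mathbb A$. (2) If $\mathrm{pow}_{k+1}\,\mathrm{lc}_{\mathbb A}(\mathcal I)$ has a solution in $\mathcal R$, then so does $\mathrm{lc}_{\mathbb A}^{k}(\mathcal I)$.
   Context: An LC (label cover) instance $\mathcal D$ consists of a finite set $X$ of variables, a finite set $\mathcal D_x$ (domain) for each $x\in X$, and a finite list of constraints of the form $x=\alpha(y)$ with $x,y\in X$ and $\alpha:\mathcal D_y\to\mathcal D_x$ a function. A minion $\mathcal R$ is a functor from finite sets to sets: it assigns a set $\mathcal R^{(D)}$ to each finite set $D$ and a map $\mathcal R^{(\alpha)}:\mathcal R^{(D)}\to\mathcal R^{(E)}$ to each function $\alpha:D\to E$ between finite sets, preserving identities and composition. A solution of $\mathcal D$ in $\mathcal R$ is a tuple $(r_x)_{x\in X}$ with $r_x\in\mathcal R^{(\mathcal D_x)}$ and $r_x=\mathcal R^{(\alpha)}(r_y)$ for every constraint $x=\alpha(y)$ of $\mathcal D$. A structure $\mathbb A$ in a signature $\Sigma$ (a set of relation symbols $R$ with arities $\mathrm{ar}(R)\in\mathbb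 N$) consists of a finite set $A$ and a relation $R^{\mathbb A}\subseteq A^{\mathrm{ar}(R)}$ for each $R\in\Sigma$. A PCSP template is a pair $(\mathbb A,\mathbb B)$ of structures in the same finite signature such that there is a homomorphism (relation-preserving map) $\mathbb A\to\mathbb B$. An instance $\mathcal I$ of $\mathrm{PCSP}(\mathbb A,\mathbb B)$ is a list of formal constraints $x_1\dots x_n\in R$ with $R\in\Sigma$, $n=\mathrm{ar}(R)$, and $x_i$ variables. The LC instance $\mathrm{lc}_{\mathbb A}(\mathcal I)$ has as variables the variables of $\mathcal I$, each with domain $A$, together with one variable $y$ with domain $R^{\mathbb A}$ for each constraint $x_1\dots x_n\in R$ of $\mathcal I$, with LC constraints $x_i=\pi_i(y)$, $i=1,\dots,n$, where $\pi_i$ is the $i$-th projection. For $m\in\mathbb N$, the LC instance $\mathrm{lc}_{\mathbb A}^m(\mathcal I)$ has as variables the sets $U$ of at most $m$ variables of $\mathcal I$; the domain of $U$ is the set of partial solutions on $U$, i.e. functions $f:U\to A$ satisfying $f(x_1)\dots f(x_n)\in R^{\mathbb A}$ for every constraint $x_1\dots x_n\in R$ of $\mathcal I$ with all $x_i\in U$; and for every inclusion $U\subseteq U'$ there is the constraint $U=\mathrm{res}(U')$, where $\mathrm{res}(f)=f|_U$. The $k$-th saturated power $\mathrm{pow}_k\,\mathcal D$ of an LC instance $\mathcal D$ with variable set $X$ is the LC instance with variable set $X^k$, domains $\mathcal D_{x_1x_2\dots x_k}=\mathcal D_{x_1}\times\cdots\times\mathcal D_{x_k}$, and the following constraints, where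 first all constraints $x=\mathrm{id}(x)$ ($x\in X$) are added to $\mathcal D$: (1) for every $k$-tuple of constraints $x_i=\alpha_i(y_i)$, $i=1,\dots,k$, of $\mathcal D$, the constraint $x_1\dots x_k=(\alpha_1\times\cdots\times\alpha_k)(y_1\dots y_k)$; (2) for every $x_1\dots x_k\in X^k$ and every function $\sigma:[k]\to[k]$, the constraint $x_{\sigma(1)}\dots x_{\sigma(k)}=\sigma^*(x_1\dots x_k)$, where $\sigma^*(d_1\dots d_k)=d_{\sigma(1)}\dots d_{\sigma(k)}$.
   Formalization: Part (2) is false as stated in degenerate cases, so it additionally assumes that the minion rejects some LC instance all of whose domains are nonempty, and that the instance I is nonempty or the minion is not constantly empty; part (1) is as stated. *)

theory Defs
  imports "HOL-Library.FuncSet"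
begin

section \<open>Minions\<close>

text \<open>
  A functor from finite sets to sets is given on the finite subsets of a type \<open>'u\<close>.  For an
  infinite type \<open>'u\<close> the finite subsets of \<open>'u\<close>, with all functions between them, form a category
  equivalent to the category of all finite sets.  Functions \<open>\<alpha> : D \<rightarrow> E\<close> are the extensional
  ones, \<open>\<alpha> \<in> D \<rightarrow>\<^sub>E E\<close>, so that each set-theoretic function has exactly one representative.
\<close>

record ('u, 'r) minion =
  Obj :: "'u set \<Rightarrow> 'r set"
  Mor :: "'u set \<Rightarrow> 'u set \<Rightarrow> ('u \<Rightarrow> 'u) \<Rightarrow> 'r \<Rightarrow> 'r"

definition is_minion :: "('u, 'r) minion \<Rightarrow> bool" where
  "is_minion \<R> \<longleftrightarrow>
     (\<forall>D E. \<forall>\<alpha> \<in> D \<rightarrow>\<^sub>E E. finite D \<longrightarrow> finite E \<longrightarrow> Mor \<R> D E \<alpha> \<in> Obj \<R> D \<rightarrow> Obj \<R> E) \<and>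
     (\<forall>D. finite D \<longrightarrow> (\<forall>r \<in> Obj \<R> D. Mor \<R> D D (\<lambda>d\<in>D. d) r = r)) \<and>
     (\<forall>D E F. \<forall>\<alpha> \<in> D \<rightarrow>\<^sub>E E. \<forall>\<beta> \<in> E \<rightarrow>\<^sub>E F. finite D \<longrightarrow> finite E \<longrightarrow> finite F \<longrightarrow>
        (\<forall>r \<in> Obj \<R> D. Mor \<R> D F (compose D \<beta> \<alpha>) r = Mor \<R> E F \<beta> (Mor \<R> D E \<alpha> r)))"

section \<open>Label cover instances\<close>

text \<open>
  The triple \<open>(x, \<alpha>, y)\<close> stands for the constraint \<open>x = \<alpha>(y)\<close>.  Constraints are collected in a
  finite set: neither their order nor their multiplicity plays a role.
\<close>

record ('x, 'u) lc =
  lvars :: "'x set"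
  ldom :: "'x \<Rightarrow> 'u set"
  lcons :: "('x \<times> ('u \<Rightarrow> 'u) \<times> 'x) set"

definition lc_instance :: "('x, 'u) lc \<Rightarrow> bool" where
  "lc_instance \<D> \<longleftrightarrow>
     finite (lvars \<D>) \<and>
     (\<forall>x \<in> lvars \<D>. finite (ldom \<D> x)) \<and>
     finite (lcons \<D>) \<and>
     (\<forall>(x, \<alpha>, y) \<in> lcons \<D>. x \<in> lvars \<D> \<and> y \<in> lvars \<D> \<and> \<alpha> \<in> ldom \<D> y \<rightarrow>\<^sub>E ldom \<D> x)"

definition solution :: "('u, 'r) minion \<Rightarrow> ('x, 'u) lc \<Rightarrow> ('x \<Rightarrow> 'r) \<Rightarrow> bool" where
  "solution \<R> \<D> r \<longleftrightarrow>
     (\<forall>x \<in> lvars \<D>. r x \<in> Obj \<R> (ldom \<D> x)) \<and>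
     (\<forall>(x, \<alpha>, y) \<in> lcons \<D>. r x = Mor \<R> (ldom \<D> y) (ldom \<D> x) \<alpha> (r y))"

definition has_solution :: "('u, 'r) minion \<Rightarrow> ('x, 'u) lc \<Rightarrow> bool" where
  "has_solution \<R> \<D> \<longleftrightarrow> (\<exists>r. solution \<R> \<D> r)"

section \<open>Structures, templates and instances\<close>

record 's signature =
  syms :: "'s set"
  ar :: "'s \<Rightarrow> nat"

record ('s, 'a) rel_struct =
  carrier :: "'a set"
  rel :: "'s \<Rightarrow> 'a list set"

definition is_structure :: "'s signature \<Rightarrow> ('s, 'a) rel_struct \<Rightarrow> bool" where
  "is_structure \<Sigma> \<A> \<longleftrightarrow>
     finite (carrier \<A>) \<and>
     (\<forall>R \<in> syms \<Sigma>. rel \<A> R \<subseteq> {as. length as = ar \<Sigma> R \<and> set as \<subseteq> carrier \<A>})"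

definition homomorphism ::
    "'s signature \<Rightarrow> ('s, 'a) rel_struct \<Rightarrow> ('s, 'b) rel_struct \<Rightarrow> ('a \<Rightarrow> 'b) \<Rightarrow> bool" where
  "homomorphism \<Sigma> \<A> \<B> h \<longleftrightarrow>
     h \<in> carrier \<A> \<rightarrow> carrier \<B> \<and> (\<forall>R \<in> syms \<Sigma>. \<forall>as \<in> rel \<A> R. map h as \<in> rel \<B> R)"

definition pcsp_template ::
    "'s signature \<Rightarrow> ('s, 'a) rel_struct \<Rightarrow> ('s, 'b) rel_struct \<Rightarrow> bool" where
  "pcsp_template \<Sigma> \<A> \<B> \<longleftrightarrow>
     finite (syms \<Sigma>) \<and> is_structure \<Sigma> \<A> \<and> is_structure \<Sigma> \<B> \<and> (\<exists>h. homomorphism \<Sigma> \<A> \<B> h)"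

text \<open>The maximal arity is \<open>0\<close> for the empty signature.\<close>

definition max_arity :: "'s signature \<Rightarrow> nat" where
  "max_arity \<Sigma> = Max (insert 0 (ar \<Sigma> ` syms \<Sigma>))"

text \<open>
  The pair \<open>(R, [x\<^sub>1, \<dots>, x\<^sub>n])\<close> stands for the formal constraint \<open>x\<^sub>1 \<dots> x\<^sub>n \<in> R\<close>.
\<close>

type_synonym ('s, 'v) pcsp_inst = "('s \<times> 'v list) list"

definition is_instance :: "'s signature \<Rightarrow> ('s, 'v) pcsp_inst \<Rightarrow> bool" where
  "is_instance \<Sigma> I \<longleftrightarrow> (\<forall>(R, xs) \<in> set I. R \<in> syms \<Sigma> \<and> length xs = ar \<Sigma> R)"

definition inst_vars :: "('s, 'v) pcsp_inst \<Rightarrow> 'v set" where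
  "inst_vars I = (\<Union>(R, xs) \<in> set I. set xs)"

section \<open>Label cover instances built from an instance\<close>

text \<open>
  All domains below must be subsets of one type: \<open>Elem\<close> embeds the elements of the structure, \<open>Tup\<close>
  forms finite tuples (members of relations and of product domains), and \<open>Asg\<close> embeds functions
  \<open>U \<rightarrow> A\<close>, represented as partial maps with domain \<open>U\<close>.  The type is infinite, hence contains a
  copy of every finite set.
\<close>

datatype ('v, 'a) val =
    Elem 'a
  | Tup (entries: "('v, 'a) val list")
  | Asg (asg: "'v \<rightharpoonup> 'a")

text \<open>
  \<open>CVar j\<close> is the variable added for the \<open>j\<close>-th constraint, so repeated constraints yield distinct
  variables.
\<close>

datatype 'v lc_var = Var 'v | CVar nat

fun lc_of_dom :: "('s, 'a) rel_struct \<Rightarrow> ('s, 'v) pcsp_inst \<Rightarrow> 'v lc_var \<Rightarrow> ('v, 'a) val set" where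
  "lc_of_dom \<A> I (Var x) = Elem ` carrier \<A>"
| "lc_of_dom \<A> I (CVar j) = (\<lambda>as. Tup (map Elem as)) ` rel \<A> (fst (I ! j))"

definition lc_of :: "('s, 'a) rel_struct \<Rightarrow> ('s, 'v) pcsp_inst \<Rightarrow> ('v lc_var, ('v, 'a) val) lc" where
  "lc_of \<A> I =
     \<lparr> lvars = Var ` inst_vars I \<union> CVar ` {..<length I},
       ldom = lc_of_dom \<A> I,
       lcons = {(Var (snd (I ! j) ! i), \<lambda>d \<in> lc_of_dom \<A> I (CVar j). entries d ! i, CVar j) | i j.
                  j < length I \<and> i < length (snd (I ! j))} \<rparr>"

definition partial_solutions ::
    "('s, 'a) rel_struct \<Rightarrow> ('s, 'v) pcsp_inst \<Rightarrow> 'v set \<Rightarrow> ('v \<rightharpoonup> 'a) set" where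
  "partial_solutions \<A> I U =
     {f. dom f = U \<and> ran f \<subseteq> carrier \<A> \<and>
         (\<forall>(R, xs) \<in> set I. set xs \<subseteq> U \<longrightarrow> map (\<lambda>x. the (f x)) xs \<in> rel \<A> R)}"

definition lc_upto_dom :: "('s, 'a) rel_struct \<Rightarrow> ('s, 'v) pcsp_inst \<Rightarrow> 'v set \<Rightarrow> ('v, 'a) val set" where
  "lc_upto_dom \<A> I U = Asg ` partial_solutions \<A> I U"

definition lc_upto :: "nat \<Rightarrow> ('s, 'a) rel_struct \<Rightarrow> ('s, 'v) pcsp_inst \<Rightarrow> ('v set, ('v, 'a) val) lc" where
  "lc_upto m \<A> I =
     \<lparr> lvars = {U. U \<subseteq> inst_vars I \<and> card U \<le> m},
       ldom = lc_upto_dom \<A> I,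
       lcons = {(U, \<lambda>d \<in> lc_upto_dom \<A> I U'. Asg (asg d |` U), U') | U U'.
                  U \<subseteq> U' \<and> U' \<subseteq> inst_vars I \<and> card U' \<le> m} \<rparr>"

section \<open>Saturated powers\<close>

text \<open>Variables of the power are lists of length \<open>k\<close> of variables.\<close>

definition add_ids :: "('x, 'u) lc \<Rightarrow> ('x \<times> ('u \<Rightarrow> 'u) \<times> 'x) set" where
  "add_ids \<D> = lcons \<D> \<union> {(x, \<lambda>d \<in> ldom \<D> x. d, x) | x. x \<in> lvars \<D>}"

definition pow_dom :: "('x, ('v, 'a) val) lc \<Rightarrow> 'x list \<Rightarrow> ('v, 'a) val set" where
  "pow_dom \<D> xs = Tup ` {ds. list_all2 (\<lambda>d x. d \<in> ldom \<D> x) ds xs}"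

definition sat_pow :: "nat \<Rightarrow> ('x, ('v, 'a) val) lc \<Rightarrow> ('x list, ('v, 'a) val) lc" where
  "sat_pow k \<D> =
     \<lparr> lvars = {xs. length xs = k \<and> set xs \<subseteq> lvars \<D>},
       ldom = pow_dom \<D>,
       lcons =
         {(map (\<lambda>(x, \<alpha>, y). x) cs,
           \<lambda>d \<in> pow_dom \<D> (map (\<lambda>(x, \<alpha>, y). y) cs).
             Tup (map2 (\<lambda>(x, \<alpha>, y) e. \<alpha> e) cs (entries d)),
           map (\<lambda>(x, \<alpha>, y). y) cs) | cs. length cs = k \<and> set cs \<subseteq> add_ids \<D>}
         \<union>
         {(map (\<lambda>i. xs ! \<sigma> i) [0..<k],
           \<lambda>d \<in> pow_dom \<D> xs. Tup (map (\<lambda>i. entries d ! \<sigma> i) [0..<k]),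
           xs) | xs \<sigma>. length xs = k \<and> set xs \<subseteq> lvars \<D> \<and> \<sigma> \<in> {..<k} \<rightarrow>\<^sub>E {..<k}} \<rparr>"

end

theory Submission
  imports Defs
begin

text \<open>
  For (1), a partial solution on the union of the scopes of \<open>x\<^sub>1, \<dots>, x\<^sub>k\<close> determines an
  element of the product of their domains, and these maps are compatible with all constraints.

  For (2), list a set \<open>U\<close> of at most \<open>k\<close> variables in a tuple of length \<open>k + 1\<close>.  The value of the
  power at this tuple yields an element \<open>r\<close> of \<open>\<R>\<close> at the set of all assignments on \<open>U\<close>, and
  the task is to show that \<open>r\<close> comes from the subset of partial solutions.  Since \<open>\<R>\<close> is
  nondegenerate, the subsets from which an element comes are closed under intersection, so one
  constraint inside \<open>U\<close> can be treated at a time.  Put its variable \<open>y\<close> into the spare entry of the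
  tuple: overwriting the entry at \<open>x\<^sub>i\<close> by \<open>\<pi>\<^sub>i(y)\<close> is induced by constraints of the power, hence
  fixes the element at the tuple, which therefore comes from the tuples whose entry at \<open>x\<^sub>i\<close> is
  \<open>\<pi>\<^sub>i(y)\<close>.  Intersecting over \<open>i\<close> leaves only tuples satisfying the constraint.
\<close>

section \<open>Pushing elements of a minion forward\<close>

text \<open>Morphisms of a minion take extensional functions. Restricting inside \<open>push\<close>
  allows any function that maps D into E to be written directly.\<close>

definition push :: "('u, 'r) minion \<Rightarrow> 'u set \<Rightarrow> 'u set \<Rightarrow> ('u \<Rightarrow> 'u) \<Rightarrow> 'r \<Rightarrow> 'r" where
  "push \<R> D E f r = Mor \<R> D E (restrict f D) r"

text \<open>The overview's notion of coming from a subset. It expresses that an abstract element of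
  a minion satisfies a condition on the members of D.\<close>

definition supported :: "('u, 'r) minion \<Rightarrow> 'u set \<Rightarrow> 'r \<Rightarrow> 'u set \<Rightarrow> bool" where
  "supported \<R> D r S \<longleftrightarrow> S \<subseteq> D \<and> (\<exists>s \<in> Obj \<R> S. r = push \<R> S D (\<lambda>d. d) s)"

lemma push_cong: "(\<And>d. d \<in> D \<Longrightarrow> f d = g d) \<Longrightarrow> push \<R> D E f r = push \<R> D E g r"
  unfolding push_def by (metis restrict_ext)

locale minion =
  fixes \<R> :: "('u, 'r) minion"
  assumes is_minion: "is_minion \<R>"
begin

lemma push_in:
  assumes "finite D" "finite E" "f \<in> D \<rightarrow> E" "r \<in> Obj \<R> D"
  shows "push \<R> D E f r \<in> Obj \<R> E"
proof -
  have maps: "\<forall>D E. \<forall>\<alpha> \<in> D \<rightarrow>\<^sub>E E. finite D \<longrightarrow> finite E \<longrightarrow> Mor \<R> D E \<alpha> \<in> Obj \<R> D \<rightarrow> Obj \<R> E"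
    using is_minion unfolding is_minion_def by (rule conjunct1)
  have "restrict f D \<in> D \<rightarrow>\<^sub>E E" using assms(3) by simp
  from maps[THEN spec, THEN spec, THEN bspec, OF this] assms(1,2)
  have "Mor \<R> D E (restrict f D) \<in> Obj \<R> D \<rightarrow> Obj \<R> E" by simp
  then show ?thesis using assms(4) unfolding push_def by (rule funcset_mem)
qed

lemma push_id:
  assumes "finite D" "r \<in> Obj \<R> D" "\<And>d. d \<in> D \<Longrightarrow> f d = d"
  shows "push \<R> D D f r = r"
proof -
  have ids: "\<forall>D. finite D \<longrightarrow> (\<forall>r \<in> Obj \<R> D. Mor \<R> D D (\<lambda>d\<in>D. d) r = r)"
    using is_minion unfolding is_minion_def by (elim conjE)
  have "push \<R> D D f r = push \<R> D D (\<lambda>d. d) r" by (rule push_cong) (rule assms(3))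
  also have "\<dots> = r" unfolding push_def using ids assms(1,2) by simp
  finally show ?thesis .
qed

lemma push_push:
  assumes "finite D" "finite E" "finite F" "f \<in> D \<rightarrow> E" "g \<in> E \<rightarrow> F" "r \<in> Obj \<R> D"
  shows "push \<R> E F g (push \<R> D E f r) = push \<R> D F (\<lambda>d. g (f d)) r"
proof -
  have comps: "\<forall>D E F. \<forall>\<alpha> \<in> D \<rightarrow>\<^sub>E E. \<forall>\<beta> \<in> E \<rightarrow>\<^sub>E F. finite D \<longrightarrow> finite E \<longrightarrow> finite F \<longrightarrow>
        (\<forall>r \<in> Obj \<R> D. Mor \<R> D F (compose D \<beta> \<alpha>) r = Mor \<R> E F \<beta> (Mor \<R> D E \<alpha> r))"
    using is_minion unfolding is_minion_def by (elim conjE)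
  have f: "restrict f D \<in> D \<rightarrow>\<^sub>E E" and g: "restrict g E \<in> E \<rightarrow>\<^sub>E F" using assms(4,5) by simp_all
  have c: "compose D (restrict g E) (restrict f D) = restrict (\<lambda>d. g (f d)) D"
    using assms(4) by (auto simp: compose_def fun_eq_iff Pi_iff)
  from comps f g assms(1,2,3,6)
  have "Mor \<R> D F (compose D (restrict g E) (restrict f D)) r
      = Mor \<R> E F (restrict g E) (Mor \<R> D E (restrict f D) r)" by simp
  then show ?thesis unfolding push_def c by simp
qed

lemma push_inclusion:
  assumes "finite D" "finite E" "S \<subseteq> D" "f \<in> D \<rightarrow> E" "s \<in> Obj \<R> S"
  shows "push \<R> D E f (push \<R> S D (\<lambda>d. d) s) = push \<R> S E f s"
  using assms finite_subset[OF assms(3,1)] by (intro push_push) auto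

lemma supported_self:
  assumes "finite D" "r \<in> Obj \<R> D"
  shows "supported \<R> D r D"
  unfolding supported_def using assms push_id[of D r "\<lambda>d. d"] by force

text \<open>The inclusion of S followed by f factors through T, so functoriality gives a preimage at
  T.\<close>

lemma supported_push:
  assumes "finite D" "finite E" "supported \<R> D r S" "f \<in> D \<rightarrow> E" "f ` S \<subseteq> T" "T \<subseteq> E"
  shows "supported \<R> E (push \<R> D E f r) T"
proof -
  obtain s where SD: "S \<subseteq> D" and s: "s \<in> Obj \<R> S" and r: "r = push \<R> S D (\<lambda>d. d) s"
    using assms unfolding supported_def by auto
  have fin: "finite S" "finite T" using SD assms finite_subset by blast+
  have fS: "f \<in> S \<rightarrow> T" using assms by auto
  have "push \<R> D E f r = push \<R> S E f s"
    unfolding r by (rule push_inclusion[OF assms(1,2) SD assms(4) s])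
  also have "\<dots> = push \<R> T E (\<lambda>d. d) (push \<R> S T f s)"
    using fin assms fS s by (subst push_push) auto
  finally show ?thesis
    unfolding supported_def using push_in[OF fin fS s] assms(6) by (intro conjI bexI)
qed

lemma supported_range:
  assumes "finite D" "finite E" "r \<in> Obj \<R> D" "f ` D \<subseteq> T" "T \<subseteq> E"
  shows "supported \<R> E (push \<R> D E f r) T"
  by (rule supported_push[OF assms(1,2) supported_self[OF assms(1,3)]]) (use assms in auto)

section \<open>Degenerate minions\<close>

text \<open>The empty set is initial: pushing r along the unique maps into all domains gives a
  family that every constraint respects.\<close>

lemma has_solution_if_Obj_empty_nonempty:
  fixes \<D> :: "('w, 'u) lc"
  assumes "r \<in> Obj \<R> {}" "lc_instance \<D>"
  shows "has_solution \<R> \<D>"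
proof -
  define s where "s x = push \<R> {} (ldom \<D> x) (\<lambda>d. d) r" for x
  have "s x \<in> Obj \<R> (ldom \<D> x)" if "x \<in> lvars \<D>" for x
    using push_in[of "{}" "ldom \<D> x" "\<lambda>d. d" r] assms that unfolding lc_instance_def s_def by auto
  moreover have "s x = Mor \<R> (ldom \<D> y) (ldom \<D> x) \<alpha> (s y)" if c: "(x, \<alpha>, y) \<in> lcons \<D>" for x \<alpha> y
  proof -
    have *: "\<alpha> \<in> ldom \<D> y \<rightarrow>\<^sub>E ldom \<D> x" "finite (ldom \<D> x)" "finite (ldom \<D> y)"
      using assms c unfolding lc_instance_def by auto
    have "Mor \<R> (ldom \<D> y) (ldom \<D> x) \<alpha> (s y) = push \<R> (ldom \<D> y) (ldom \<D> x) \<alpha> (s y)"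
      using * by (simp add: push_def PiE_restrict)
    also have "\<dots> = push \<R> {} (ldom \<D> x) \<alpha> r"
      unfolding s_def using * assms(1) by (intro push_inclusion) auto
    also have "\<dots> = s x" unfolding s_def by (rule push_cong) simp
    finally show ?thesis by simp
  qed
  ultimately show ?thesis unfolding has_solution_def solution_def by blast
qed

text \<open>Two disjoint supports force all constant maps to push r to the same element. Pushing r
  to a constant in each domain is then compatible with all constraints; nonempty domains supply the
  constants.\<close>

lemma has_solution_if_disjoint_supports:
  fixes \<D> :: "('w, 'u) lc"
  assumes D: "finite D" and r: "r \<in> Obj \<R> D"
    and S: "supported \<R> D r S" and T: "supported \<R> D r T" and ST: "S \<inter> T = {}"
    and \<D>: "lc_instance \<D>" "\<forall>x \<in> lvars \<D>. ldom \<D> x \<noteq> {}"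
  shows "has_solution \<R> \<D>"
proof -
  text \<open>A function that is \<open>e\<close> on \<open>S\<close> and \<open>e'\<close> on \<open>T\<close> acts on \<open>r\<close> like both constant functions.\<close>
  have const_eq: "push \<R> D E (\<lambda>_. e) r = push \<R> D E (\<lambda>_. e') r"
    if E: "finite E" "e \<in> E" "e' \<in> E" for E e e'
  proof -
    define g where "g = (\<lambda>d. if d \<in> S then e else e')"
    have agree: "push \<R> D E g r = push \<R> D E (\<lambda>_. c) r"
      if P: "supported \<R> D r P" and c: "c \<in> E" "\<And>d. d \<in> P \<Longrightarrow> g d = c" for P c
    proof -
      obtain p where p: "P \<subseteq> D" "p \<in> Obj \<R> P" "r = push \<R> P D (\<lambda>d. d) p"
        using P unfolding supported_def by auto
      have "push \<R> D E g r = push \<R> P E g p"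
        unfolding p(3) using p D E by (intro push_inclusion) (auto simp: g_def)
      also have "\<dots> = push \<R> P E (\<lambda>_. c) p" using c by (intro push_cong) auto
      also have "\<dots> = push \<R> D E (\<lambda>_. c) r"
        unfolding p(3) using p D E c by (intro push_inclusion[symmetric]) auto
      finally show ?thesis .
    qed
    have "push \<R> D E g r = push \<R> D E (\<lambda>_. e) r" using agree[OF S, of e] E by (auto simp: g_def)
    moreover have "push \<R> D E g r = push \<R> D E (\<lambda>_. e') r"
      using E ST by (intro agree[OF T]) (auto simp: g_def)
    ultimately show ?thesis by simp
  qed
  define s where "s x = push \<R> D (ldom \<D> x) (\<lambda>_. SOME e. e \<in> ldom \<D> x) r" for x
  have some: "(SOME e. e \<in> ldom \<D> x) \<in> ldom \<D> x" if "x \<in> lvars \<D>" for x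
    using \<D>(2) that by (simp add: some_in_eq)
  have "s x \<in> Obj \<R> (ldom \<D> x)" if "x \<in> lvars \<D>" for x
    unfolding s_def using that some \<D> D r unfolding lc_instance_def by (intro push_in) auto
  moreover have "s x = Mor \<R> (ldom \<D> y) (ldom \<D> x) \<alpha> (s y)" if c: "(x, \<alpha>, y) \<in> lcons \<D>" for x \<alpha> y
  proof -
    have *: "x \<in> lvars \<D>" "y \<in> lvars \<D>" "\<alpha> \<in> ldom \<D> y \<rightarrow>\<^sub>E ldom \<D> x"
      "finite (ldom \<D> x)" "finite (ldom \<D> y)"
      using \<D> c unfolding lc_instance_def by auto
    have "Mor \<R> (ldom \<D> y) (ldom \<D> x) \<alpha> (s y) = push \<R> (ldom \<D> y) (ldom \<D> x) \<alpha> (s y)"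
      using * by (simp add: push_def PiE_restrict)
    also have "\<dots> = push \<R> D (ldom \<D> x) (\<lambda>_. \<alpha> (SOME e. e \<in> ldom \<D> y)) r"
      unfolding s_def using * some D r by (subst push_push) auto
    \<comment> \<open>The map \<open>\<alpha>\<close> need not send the constant chosen for y to the
      one chosen for x; \<open>const_eq\<close> identifies the two pushes.\<close>
    also have "\<dots> = s x"
      unfolding s_def using * some by (intro const_eq) auto
    finally show ?thesis by simp
  qed
  ultimately show ?thesis unfolding has_solution_def solution_def by blast
qed

end

section \<open>Supports in a nondegenerate minion\<close>

text \<open>Any rejected instance forces the first property, and one with nonempty domains forces
  the second.\<close>

locale nondegenerate_minion = minion +
  assumes Obj_empty: "Obj \<R> {} = {}"
    and no_disjoint_supports:
      "\<lbrakk>finite D; r \<in> Obj \<R> D; supported \<R> D r S; supported \<R> D r T\<rbrakk> \<Longrightarrow> S \<inter> T \<noteq> {}"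
begin

text \<open>The map e is the identity on S and sends everything else to a point p of the
  intersection, which exists because supports meet. It fixes r because r comes from S, and it maps T
  into the intersection.\<close>

lemma supported_Int:
  assumes D: "finite D" and r: "r \<in> Obj \<R> D"
    and S: "supported \<R> D r S" and T: "supported \<R> D r T"
  shows "supported \<R> D r (S \<inter> T)"
proof -
  obtain p where p: "p \<in> S" "p \<in> T" using no_disjoint_supports[OF assms] by auto
  define e where "e = (\<lambda>d. if d \<in> S then d else p)"
  obtain s where s: "S \<subseteq> D" "s \<in> Obj \<R> S" "r = push \<R> S D (\<lambda>d. d) s"
    using S unfolding supported_def by auto
  have eD: "e \<in> D \<rightarrow> D" using p s(1) by (auto simp: e_def)
  have "push \<R> D D e r = push \<R> S D e s"
    unfolding s(3) by (rule push_inclusion[OF D D s(1) eD s(2)])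
  also have "\<dots> = r" unfolding s(3) by (rule push_cong) (simp add: e_def)
  finally have er: "push \<R> D D e r = r" .
  have "supported \<R> D (push \<R> D D e r) (S \<inter> T)"
    by (rule supported_push[OF D D T eD]) (use p s(1) in \<open>auto simp: e_def\<close>)
  then show ?thesis by (simp add: er)
qed

text \<open>The intersection with D gives the empty family the value D instead of the universal
  set.\<close>

lemma supported_INT:
  assumes "finite D" "r \<in> Obj \<R> D" "finite J" "\<And>i. i \<in> J \<Longrightarrow> supported \<R> D r (S i)"
  shows "supported \<R> D r (D \<inter> (\<Inter>i\<in>J. S i))"
  using assms(3,4)
proof (induction J rule: finite_induct)
  case empty
  then show ?case using supported_self assms by simp
next
  case (insert j J)
  have "supported \<R> D r (S j)" "supported \<R> D r (D \<inter> (\<Inter>i\<in>J. S i))"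
    using insert.prems insert.IH by simp_all
  then have "supported \<R> D r (S j \<inter> (D \<inter> (\<Inter>i\<in>J. S i)))"
    by (rule supported_Int[OF assms(1,2)])
  moreover have "S j \<inter> (D \<inter> (\<Inter>i\<in>J. S i)) = D \<inter> (\<Inter>i\<in>insert j J. S i)" by blast
  ultimately show ?case by (simp only:)
qed

text \<open>The inclusion of S has a left inverse, since S cannot be empty when it carries an
  element. Lifts to smaller sets are therefore unique, which later makes the lifted family
  compatible.\<close>

lemma push_inclusion_inject:
  assumes "finite D" "S \<subseteq> D" "s \<in> Obj \<R> S" "t \<in> Obj \<R> S"
    and eq: "push \<R> S D (\<lambda>d. d) s = push \<R> S D (\<lambda>d. d) t"
  shows "s = t"
proof -
  obtain p where p: "p \<in> S" using assms(3) Obj_empty by (cases "S = {}") auto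
  define e where "e = (\<lambda>d. if d \<in> S then d else p)"
  have fS: "finite S" by (rule finite_subset[OF assms(2,1)])
  have eD: "e \<in> D \<rightarrow> S" using p by (simp add: e_def)
  have "push \<R> D S e (push \<R> S D (\<lambda>d. d) u) = u" if "u \<in> Obj \<R> S" for u
  proof -
    have "push \<R> D S e (push \<R> S D (\<lambda>d. d) u) = push \<R> S S e u"
      by (rule push_inclusion[OF assms(1) fS assms(2) eD that])
    also have "\<dots> = u" by (rule push_id[OF fS that]) (simp add: e_def)
    finally show ?thesis .
  qed
  from this[OF assms(3), unfolded eq] this[OF assms(4)] show ?thesis by (rule trans[OF sym])
qed

end

section \<open>Domains\<close>

lemma finite_partial_solutions:
  assumes "finite (carrier \<A>)" "finite U"
  shows "finite (partial_solutions \<A> I U)"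
proof -
  have "partial_solutions \<A> I U \<subseteq> {f. dom f = U \<and> ran f \<subseteq> carrier \<A>}"
    unfolding partial_solutions_def by blast
  then show ?thesis by (rule finite_subset[OF _ finite_set_of_finite_maps[OF assms(2,1)]])
qed

lemma partial_solution_constraint:
  assumes "f \<in> partial_solutions \<A> I U" "(R, xs) \<in> set I" "set xs \<subseteq> U"
  shows "map (\<lambda>x. the (f x)) xs \<in> rel \<A> R"
proof -
  have "\<forall>(R, xs) \<in> set I. set xs \<subseteq> U \<longrightarrow> map (\<lambda>x. the (f x)) xs \<in> rel \<A> R"
    using assms(1) unfolding partial_solutions_def by simp
  from bspec[OF this assms(2)] assms(3) show ?thesis by simp
qed

lemma finite_inst_vars: "finite (inst_vars I)"
  unfolding inst_vars_def by auto

lemma nth_scope_in_inst_vars: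
  "\<lbrakk>j < length I; i < length (snd (I ! j))\<rbrakk> \<Longrightarrow> snd (I ! j) ! i \<in> inst_vars I"
  unfolding inst_vars_def split_beta by (blast intro: nth_mem)

lemma mem_pow_dom_iff:
  "d \<in> pow_dom \<D> xs \<longleftrightarrow> (\<exists>ds. d = Tup ds \<and> length ds = length xs \<and>
     (\<forall>i<length xs. ds ! i \<in> ldom \<D> (xs ! i)))"
  unfolding pow_dom_def by (auto simp: list_all2_conv_all_nth)

lemma finite_pow_dom:
  assumes "\<And>x. x \<in> set xs \<Longrightarrow> finite (ldom \<D> x)"
  shows "finite (pow_dom \<D> xs)"
proof -
  have "set ds \<subseteq> (\<Union>x\<in>set xs. ldom \<D> x)"
    if ds: "length ds = length xs" "\<And>i. i < length xs \<Longrightarrow> ds ! i \<in> ldom \<D> (xs ! i)" for ds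
  proof
    fix d assume "d \<in> set ds"
    then obtain i where "i < length xs" "d = ds ! i" using ds(1) by (auto simp: in_set_conv_nth)
    then show "d \<in> (\<Union>x\<in>set xs. ldom \<D> x)" using ds(2) nth_mem by blast
  qed
  then have "pow_dom \<D> xs \<subseteq> Tup ` {ds. set ds \<subseteq> (\<Union>x\<in>set xs. ldom \<D> x) \<and> length ds = length xs}"
    by (auto simp: mem_pow_dom_iff)
  moreover have "finite {ds. set ds \<subseteq> (\<Union>x\<in>set xs. ldom \<D> x) \<and> length ds = length xs}"
    using assms by (intro finite_lists_length_eq) auto
  ultimately show ?thesis by (blast intro: finite_subset[OF _ finite_imageI])
qed

locale pcsp_data =
  fixes \<Sigma> :: "'s signature" and \<A> :: "('s, 'a) rel_struct" and I :: "('s, 'v) pcsp_inst"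
  assumes struct: "is_structure \<Sigma> \<A>" and inst: "is_instance \<Sigma> I"
    and finite_syms: "finite (syms \<Sigma>)"
begin

abbreviation scope_list :: "nat \<Rightarrow> 'v list" where
  "scope_list j \<equiv> snd (I ! j)"

lemma constraint_props:
  assumes "j < length I"
  shows "fst (I ! j) \<in> syms \<Sigma>" "length (scope_list j) = ar \<Sigma> (fst (I ! j))"
    "(fst (I ! j), scope_list j) \<in> set I"
  using inst assms unfolding is_instance_def by (auto simp: split_beta)

lemma finite_carrier: "finite (carrier \<A>)"
  using struct unfolding is_structure_def by auto

lemma rel_props:
  assumes "j < length I" "as \<in> rel \<A> (fst (I ! j))"
  shows "length as = length (scope_list j)" "set as \<subseteq> carrier \<A>"
  using struct assms constraint_props[OF assms(1)] unfolding is_structure_def by auto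

lemma finite_lc_of_dom:
  assumes "x \<in> lvars (lc_of \<A> I)"
  shows "finite (ldom (lc_of \<A> I) x)"
proof (cases x)
  case (Var v)
  then show ?thesis using finite_carrier by (simp add: lc_of_def)
next
  case (CVar j)
  then have j: "j < length I" using assms by (auto simp: lc_of_def)
  have "rel \<A> (fst (I ! j)) \<subseteq> {as. set as \<subseteq> carrier \<A> \<and> length as = length (scope_list j)}"
    using rel_props[OF j] by auto
  then have "finite (rel \<A> (fst (I ! j)))"
    using finite_lists_length_eq[OF finite_carrier] finite_subset by blast
  then show ?thesis using CVar by (simp add: lc_of_def)
qed

lemma finite_pow_dom_lc_of:
  "set xs \<subseteq> lvars (lc_of \<A> I) \<Longrightarrow> finite (pow_dom (lc_of \<A> I) xs)"
  by (intro finite_pow_dom finite_lc_of_dom) auto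

lemma finite_lc_upto_dom: "U \<subseteq> inst_vars I \<Longrightarrow> finite (lc_upto_dom \<A> I U)"
  unfolding lc_upto_dom_def
  by (intro finite_imageI finite_partial_solutions finite_carrier finite_subset[OF _ finite_inst_vars])

section \<open>From bounded-size partial solutions to the saturated power\<close>

fun scope :: "'v lc_var \<Rightarrow> 'v set" where
  "scope (Var v) = {v}"
| "scope (CVar j) = set (scope_list j)"

fun value_at :: "('v \<rightharpoonup> 'a) \<Rightarrow> 'v lc_var \<Rightarrow> ('v, 'a) val" where
  "value_at f (Var v) = Elem (the (f v))"
| "value_at f (CVar j) = Tup (map Elem (map (\<lambda>x. the (f x)) (scope_list j)))"

definition scopes :: "'v lc_var list \<Rightarrow> 'v set" where
  "scopes xs = (\<Union>x\<in>set xs. scope x)"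

text \<open>The map of the overview from partial solutions on \<open>scopes xs\<close> to the
  product of the domains.\<close>

definition tuple_at :: "'v lc_var list \<Rightarrow> ('v, 'a) val \<Rightarrow> ('v, 'a) val" where
  "tuple_at xs d = Tup (map (value_at (asg d)) xs)"

lemma value_at_restrict: "scope x \<subseteq> V \<Longrightarrow> value_at (f |` V) x = value_at f x"
  by (cases x) (auto simp: restrict_map_def)

text \<open>At a constraint variable this is the defining property of a partial solution, available
  because the whole scope lies in V.\<close>

lemma value_at_in:
  assumes f: "f \<in> partial_solutions \<A> I V" and "scope x \<subseteq> V" "x \<in> lvars (lc_of \<A> I)"
  shows "value_at f x \<in> ldom (lc_of \<A> I) x"
proof (cases x)
  case (Var v)
  then have "v \<in> dom f" using assms unfolding partial_solutions_def by auto
  then show ?thesis using f Var unfolding partial_solutions_def lc_of_def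
    by (auto simp: ran_def)
next
  case (CVar j)
  then have j: "j < length I" using assms by (auto simp: lc_of_def)
  then have "map (\<lambda>x. the (f x)) (scope_list j) \<in> rel \<A> (fst (I ! j))"
    using partial_solution_constraint[OF f constraint_props(3)[OF j]] assms CVar by simp
  then show ?thesis using CVar by (auto simp: lc_of_def simp del: map_map)
qed

lemma scope_subset_inst_vars: "x \<in> lvars (lc_of \<A> I) \<Longrightarrow> scope x \<subseteq> inst_vars I"
  by (cases x) (auto simp: lc_of_def in_set_conv_nth nth_scope_in_inst_vars)

text \<open>Each constraint is an added identity or a projection from a constraint variable to an
  entry of its scope. The last claim is naturality of evaluation.\<close>

lemma add_ids_props:
  assumes "(x, \<alpha>, y) \<in> add_ids (lc_of \<A> I)"
  shows "x \<in> lvars (lc_of \<A> I)" "y \<in> lvars (lc_of \<A> I)" "scope x \<subseteq> scope y"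
    "\<alpha> \<in> ldom (lc_of \<A> I) y \<rightarrow> ldom (lc_of \<A> I) x"
    "\<lbrakk>f \<in> partial_solutions \<A> I V; scope y \<subseteq> V\<rbrakk> \<Longrightarrow> \<alpha> (value_at f y) = value_at f x"
proof -
  consider "x = y" "x \<in> lvars (lc_of \<A> I)" "\<alpha> = (\<lambda>d \<in> ldom (lc_of \<A> I) x. d)"
    | i j where "j < length I" "i < length (scope_list j)" "x = Var (scope_list j ! i)"
      "y = CVar j" "\<alpha> = (\<lambda>d \<in> lc_of_dom \<A> I (CVar j). entries d ! i)"
    using assms unfolding add_ids_def by (auto simp: lc_of_def)
  note cases = this
  show "x \<in> lvars (lc_of \<A> I)" "y \<in> lvars (lc_of \<A> I)" "scope x \<subseteq> scope y"
    by (cases rule: cases; auto simp: lc_of_def nth_scope_in_inst_vars)+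
  show "\<alpha> \<in> ldom (lc_of \<A> I) y \<rightarrow> ldom (lc_of \<A> I) x"
    using rel_props nth_mem by (cases rule: cases) (fastforce simp: lc_of_def)+
  show "\<alpha> (value_at f y) = value_at f x"
    if f: "f \<in> partial_solutions \<A> I V" "scope y \<subseteq> V"
    using value_at_in[OF f] \<open>y \<in> lvars (lc_of \<A> I)\<close>
    by (cases rule: cases) (auto simp: lc_of_def)
qed

lemma map_constraints_in:
  assumes cs: "set cs \<subseteq> add_ids (lc_of \<A> I)"
  shows "(\<lambda>d. Tup (map2 (\<lambda>(x, \<alpha>, y) e. \<alpha> e) cs (entries d)))
    \<in> pow_dom (lc_of \<A> I) (map (\<lambda>(x, \<alpha>, y). y) cs) \<rightarrow> pow_dom (lc_of \<A> I) (map (\<lambda>(x, \<alpha>, y). x) cs)"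
proof
  note ids = add_ids_props[OF subsetD[OF cs]]
  fix d assume "d \<in> pow_dom (lc_of \<A> I) (map (\<lambda>(x, \<alpha>, y). y) cs)"
  then obtain ds where ds: "d = Tup ds" "length ds = length cs"
      "\<And>i. i < length cs \<Longrightarrow> ds ! i \<in> ldom (lc_of \<A> I) (case cs ! i of (x, \<alpha>, y) \<Rightarrow> y)"
    by (auto simp: mem_pow_dom_iff)
  have "(case cs ! i of (x, \<alpha>, y) \<Rightarrow> \<lambda>e. \<alpha> e) (ds ! i) \<in> ldom (lc_of \<A> I) (case cs ! i of (x, \<alpha>, y) \<Rightarrow> x)"
    if "i < length cs" for i
    using ds(3)[OF that] ids(4) nth_mem[OF that]
    by (auto simp: Pi_iff split: prod.splits)
  then show "Tup (map2 (\<lambda>(x, \<alpha>, y) e. \<alpha> e) cs (entries d)) \<in> pow_dom (lc_of \<A> I) (map (\<lambda>(x, \<alpha>, y). x) cs)"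
    using ds by (auto simp: mem_pow_dom_iff split_beta)
qed

lemma card_scope_le:
  assumes "x \<in> lvars (lc_of \<A> I)"
  shows "card (scope x) \<le> max_arity \<Sigma>"
proof -
  have le: "length (scope_list j) \<le> max_arity \<Sigma>" if "j < length I" for j
    unfolding max_arity_def using constraint_props[OF that] finite_syms by (intro Max_ge) auto
  show ?thesis
  proof (cases x)
    \<comment> \<open>A singleton needs maximal arity at least 1, which holds because v occurs in
      some constraint.\<close>
    case (Var v)
    then have "v \<in> inst_vars I" using assms by (auto simp: lc_of_def)
    then obtain c where "c \<in> set I" "v \<in> set (snd c)" unfolding inst_vars_def by auto
    then obtain j where "j < length I" "v \<in> set (scope_list j)" by (metis in_set_conv_nth)
    then have "1 \<le> max_arity \<Sigma>" using le[of j] by (cases "scope_list j") auto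
    then show ?thesis using Var by simp
  next
    case (CVar j)
    then have "j < length I" using assms by (auto simp: lc_of_def)
    then show ?thesis using CVar le[of j] card_length[of "scope_list j"] by simp
  qed
qed

text \<open>A union bound over the entries; for tuples of length k it accounts for the bound nk in
  the first implication.\<close>

lemma card_scopes_le:
  assumes "set xs \<subseteq> lvars (lc_of \<A> I)"
  shows "card (scopes xs) \<le> max_arity \<Sigma> * length xs"
  using assms
proof (induction xs)
  case (Cons x xs)
  have "scopes (x # xs) = scope x \<union> scopes xs" by (auto simp: scopes_def)
  then have "card (scopes (x # xs)) \<le> card (scope x) + card (scopes xs)" by (simp add: card_Un_le)
  then show ?case using Cons card_scope_le[of x] by simp
qed (simp add: scopes_def)

lemma scopes_subset_inst_vars: "set xs \<subseteq> lvars (lc_of \<A> I) \<Longrightarrow> scopes xs \<subseteq> inst_vars I"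
  using scope_subset_inst_vars unfolding scopes_def by blast

lemma tuple_at_in:
  assumes "set xs \<subseteq> lvars (lc_of \<A> I)" "scopes xs \<subseteq> V" "d \<in> lc_upto_dom \<A> I V"
  shows "tuple_at xs d \<in> pow_dom (lc_of \<A> I) xs"
proof -
  obtain f where f: "d = Asg f" "f \<in> partial_solutions \<A> I V"
    using assms by (auto simp: lc_upto_dom_def)
  have "value_at f (xs ! i) \<in> ldom (lc_of \<A> I) (xs ! i)" if "i < length xs" for i
    using that nth_mem[OF that] assms unfolding scopes_def by (intro value_at_in[OF f(2)]) blast+
  then show ?thesis unfolding mem_pow_dom_iff tuple_at_def f by auto
qed

lemma restrict_asg_in:
  assumes "U \<subseteq> V" "d \<in> lc_upto_dom \<A> I V"
  shows "Asg (asg d |` U) \<in> lc_upto_dom \<A> I U"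
proof -
  obtain f where f: "d = Asg f" "f \<in> partial_solutions \<A> I V"
    using assms by (auto simp: lc_upto_dom_def)
  have "map (\<lambda>x. the ((f |` U) x)) xs \<in> rel \<A> R" if "(R, xs) \<in> set I" "set xs \<subseteq> U" for R xs
  proof -
    have "map (\<lambda>x. the ((f |` U) x)) xs = map (\<lambda>x. the (f x)) xs"
      using that by (auto simp: restrict_map_def)
    then show ?thesis using partial_solution_constraint[OF f(2) that(1)] that(2) assms(1) by (simp only: subset_trans)
  qed
  moreover have "dom (f |` U) = U" using f assms unfolding partial_solutions_def by auto
  moreover have "ran (f |` U) \<subseteq> carrier \<A>"
    using f assms ran_restrictD unfolding partial_solutions_def by (fastforce simp: ran_def restrict_map_def split: if_splits)
  ultimately have "f |` U \<in> partial_solutions \<A> I U" unfolding partial_solutions_def by blast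
  then show ?thesis by (simp add: f(1) lc_upto_dom_def)
qed

theorem has_solution_sat_pow:
  fixes \<R> :: "(('v, 'a) val, 'r) minion"
  assumes "is_minion \<R>" "has_solution \<R> (lc_upto (max_arity \<Sigma> * k) \<A> I)"
  shows "has_solution \<R> (sat_pow k (lc_of \<A> I))"
proof -
  interpret minion \<R> by (rule minion.intro) fact
  let ?L = "lc_of \<A> I" and ?m = "max_arity \<Sigma> * k" and ?P = "lc_upto_dom \<A> I"
  obtain s where s: "solution \<R> (lc_upto ?m \<A> I) s"
    using assms unfolding has_solution_def by auto
  have s_in: "s U \<in> Obj \<R> (?P U)" if "U \<subseteq> inst_vars I" "card U \<le> ?m" for U
    using s that unfolding solution_def lc_upto_def by auto
  have s_res: "s U = push \<R> (?P V) (?P U) (\<lambda>d. Asg (asg d |` U)) (s V)"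
    if "U \<subseteq> V" "V \<subseteq> inst_vars I" "card V \<le> ?m" for U V
    using s that unfolding solution_def lc_upto_def push_def by fastforce
  define r where "r xs = push \<R> (?P (scopes xs)) (pow_dom ?L xs) (tuple_at xs) (s (scopes xs))" for xs
  have sc: "scopes xs \<subseteq> inst_vars I" "card (scopes xs) \<le> ?m" "finite (?P (scopes xs))"
      "finite (pow_dom ?L xs)" "s (scopes xs) \<in> Obj \<R> (?P (scopes xs))"
    if "length xs = k" "set xs \<subseteq> lvars ?L" for xs
    using that card_scopes_le[of xs] scopes_subset_inst_vars[of xs]
    by (auto intro!: finite_lc_upto_dom finite_pow_dom_lc_of s_in)
  \<comment> \<open>Both kinds of constraints of the power have this form. As
    \<open>scopes xs\<close> is contained in \<open>scopes ys\<close>, the value of s at the former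
    is a restriction of its value at the latter, so both sides are pushes of one element and
    \<open>comm\<close> compares the maps.\<close>
  have step: "r xs = push \<R> (pow_dom ?L ys) (pow_dom ?L xs) \<alpha> (r ys)"
    if xs: "length xs = k" "set xs \<subseteq> lvars ?L" and ys: "length ys = k" "set ys \<subseteq> lvars ?L"
      and sub: "scopes xs \<subseteq> scopes ys" and \<alpha>: "\<alpha> \<in> pow_dom ?L ys \<rightarrow> pow_dom ?L xs"
      and comm: "\<And>f. f \<in> partial_solutions \<A> I (scopes ys) \<Longrightarrow> \<alpha> (tuple_at ys (Asg f)) = tuple_at xs (Asg f)"
    for xs ys \<alpha>
  proof -
    let ?X = "scopes xs" and ?Y = "scopes ys"
    have "r xs = push \<R> (?P ?Y) (pow_dom ?L xs) (\<lambda>d. tuple_at xs (Asg (asg d |` ?X))) (s ?Y)"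
      unfolding r_def s_res[OF sub sc(1,2)[OF ys]]
      using sc[OF xs] sc[OF ys] tuple_at_in[OF xs(2)] restrict_asg_in[OF sub]
      by (subst push_push) auto
    also have "\<dots> = push \<R> (?P ?Y) (pow_dom ?L xs) (\<lambda>d. \<alpha> (tuple_at ys d)) (s ?Y)"
    proof (intro push_cong)
      fix d assume "d \<in> ?P ?Y"
      then obtain f where f: "d = Asg f" "f \<in> partial_solutions \<A> I ?Y"
        by (auto simp: lc_upto_dom_def)
      have "value_at (f |` ?X) x = value_at f x" if "x \<in> set xs" for x
        using that by (intro value_at_restrict) (auto simp: scopes_def)
      then show "tuple_at xs (Asg (asg d |` ?X)) = \<alpha> (tuple_at ys d)"
        using comm[OF f(2)] by (simp add: f tuple_at_def)
    qed
    also have "\<dots> = push \<R> (pow_dom ?L ys) (pow_dom ?L xs) \<alpha> (r ys)"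
      unfolding r_def using sc[OF xs] sc[OF ys] tuple_at_in[OF ys(2)] \<alpha>
      by (subst push_push) auto
    finally show ?thesis .
  qed
  have "r xs \<in> Obj \<R> (pow_dom ?L xs)" if xs: "length xs = k" "set xs \<subseteq> lvars ?L" for xs
    unfolding r_def using sc[OF xs] tuple_at_in[OF xs(2)] by (intro push_in) auto
  \<comment> \<open>Constraints of kind (1) act componentwise and commute with evaluation by
    \<open>add_ids_props\<close>.\<close>
  moreover have "r (map (\<lambda>(x, \<alpha>, y). x) cs)
      = push \<R> (pow_dom ?L (map (\<lambda>(x, \<alpha>, y). y) cs)) (pow_dom ?L (map (\<lambda>(x, \<alpha>, y). x) cs))
         (\<lambda>d. Tup (map2 (\<lambda>(x, \<alpha>, y) e. \<alpha> e) cs (entries d))) (r (map (\<lambda>(x, \<alpha>, y). y) cs))"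
    if k: "length cs = k" and cs: "set cs \<subseteq> add_ids ?L" for cs
  proof (rule step)
    note ids = add_ids_props[OF subsetD[OF cs]]
    show "set (map (\<lambda>(x, \<alpha>, y). x) cs) \<subseteq> lvars ?L" "set (map (\<lambda>(x, \<alpha>, y). y) cs) \<subseteq> lvars ?L"
      using ids(1,2) by auto
    show "scopes (map (\<lambda>(x, \<alpha>, y). x) cs) \<subseteq> scopes (map (\<lambda>(x, \<alpha>, y). y) cs)"
    proof
      fix v assume "v \<in> scopes (map (\<lambda>(x, \<alpha>, y). x) cs)"
      then obtain x \<alpha> y where c: "(x, \<alpha>, y) \<in> set cs" "v \<in> scope x" by (auto simp: scopes_def)
      then have "v \<in> scope y" using ids(3) by blast
      then show "v \<in> scopes (map (\<lambda>(x, \<alpha>, y). y) cs)"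
        using c(1) unfolding scopes_def by (auto intro!: bexI[of _ "(x, \<alpha>, y)"])
    qed
    show "(\<lambda>d. Tup (map2 (\<lambda>(x, \<alpha>, y) e. \<alpha> e) cs (entries d)))
        \<in> pow_dom ?L (map (\<lambda>(x, \<alpha>, y). y) cs) \<rightarrow> pow_dom ?L (map (\<lambda>(x, \<alpha>, y). x) cs)"
      using cs by (rule map_constraints_in)
    show "Tup (map2 (\<lambda>(x, \<alpha>, y) e. \<alpha> e) cs (entries (tuple_at (map (\<lambda>(x, \<alpha>, y). y) cs) (Asg f))))
        = tuple_at (map (\<lambda>(x, \<alpha>, y). x) cs) (Asg f)"
      if f: "f \<in> partial_solutions \<A> I (scopes (map (\<lambda>(x, \<alpha>, y). y) cs))" for f
    proof -
      have "\<alpha> (value_at f y) = value_at f x" if c: "(x, \<alpha>, y) \<in> set cs" for x \<alpha> y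
      proof (rule ids(5)[OF c f])
        show "scope y \<subseteq> scopes (map (\<lambda>(x, \<alpha>, y). y) cs)"
          using c unfolding scopes_def by (auto intro!: bexI[of _ "(x, \<alpha>, y)"])
      qed
      then have "fst (snd (cs ! i)) (value_at f (snd (snd (cs ! i)))) = value_at f (fst (cs ! i))"
        if "i < length cs" for i
        using nth_mem[OF that] by (metis prod.collapse)
      then show ?thesis
        by (auto simp: tuple_at_def split_beta intro!: nth_equalityI)
    qed
  qed (use k in auto)
  \<comment> \<open>Constraints of kind (2): a reindexed tuple involves no new variables, and
    evaluation is entrywise.\<close>
  moreover have "r (map (\<lambda>i. xs ! \<sigma> i) [0..<k])
      = push \<R> (pow_dom ?L xs) (pow_dom ?L (map (\<lambda>i. xs ! \<sigma> i) [0..<k]))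
         (\<lambda>d. Tup (map (\<lambda>i. entries d ! \<sigma> i) [0..<k])) (r xs)"
    if xs: "length xs = k" "set xs \<subseteq> lvars ?L" and \<sigma>: "\<sigma> \<in> {..<k} \<rightarrow>\<^sub>E {..<k}" for xs \<sigma>
  proof (rule step)
    have "\<sigma> i < k" if "i < k" for i using \<sigma> that by auto
    note lt = this
    then have mem: "xs ! \<sigma> i \<in> set xs" if "i < k" for i using that xs by auto
    then show "set (map (\<lambda>i. xs ! \<sigma> i) [0..<k]) \<subseteq> lvars ?L" using xs by auto
    show "scopes (map (\<lambda>i. xs ! \<sigma> i) [0..<k]) \<subseteq> scopes xs"
      using mem by (fastforce simp: scopes_def)
    show "(\<lambda>d. Tup (map (\<lambda>i. entries d ! \<sigma> i) [0..<k]))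
        \<in> pow_dom ?L xs \<rightarrow> pow_dom ?L (map (\<lambda>i. xs ! \<sigma> i) [0..<k])"
      using lt xs by (auto simp: mem_pow_dom_iff)
    show "Tup (map (\<lambda>i. entries (tuple_at xs (Asg f)) ! \<sigma> i) [0..<k])
        = tuple_at (map (\<lambda>i. xs ! \<sigma> i) [0..<k]) (Asg f)" for f
      using lt xs by (auto simp: tuple_at_def)
  qed (use xs in auto)
  ultimately have "solution \<R> (sat_pow k ?L) r"
    unfolding solution_def sat_pow_def push_def by auto
  then show ?thesis unfolding has_solution_def by blast
qed

end


section \<open>From the saturated power to bounded-size partial solutions\<close>

text \<open>A distinct list of X is padded by repeating one of its elements, hence the need for X to
  be nonempty.\<close>

lemma obtain_list_of_length:
  assumes "finite X" "X \<noteq> {}" "card X \<le> m"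
  obtains xs where "set xs = X" "length xs = m"
proof -
  obtain ys where ys: "set ys = X" "distinct ys" using finite_distinct_list[OF assms(1)] by blast
  then have len: "length ys \<le> m" using assms(3) distinct_card by fastforce
  have "hd ys \<in> X" using ys assms(2) by (metis hd_in_set set_empty)
  then have "set (ys @ replicate (m - length ys) (hd ys)) = X" using ys by auto
  then show ?thesis using len by (intro that[of "ys @ replicate (m - length ys) (hd ys)"]) simp_all
qed

definition index_of :: "'x list \<Rightarrow> 'x \<Rightarrow> nat" where
  "index_of xs x = (SOME i. i < length xs \<and> xs ! i = x)"

lemma index_of:
  assumes "x \<in> set xs"
  shows "index_of xs x < length xs" "xs ! index_of xs x = x"
proof -
  have "\<exists>i. i < length xs \<and> xs ! i = x" using assms by (simp add: in_set_conv_nth)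
  then have "index_of xs x < length xs \<and> xs ! index_of xs x = x"
    unfolding index_of_def by (rule someI_ex)
  then show "index_of xs x < length xs" "xs ! index_of xs x = x" by simp_all
qed

fun elem_of :: "('v, 'a) val \<Rightarrow> 'a" where
  "elem_of (Elem a) = a"

definition read :: "'v set \<Rightarrow> 'v lc_var list \<Rightarrow> ('v, 'a) val \<Rightarrow> ('v, 'a) val" where
  "read U xs d = Asg (\<lambda>u. if u \<in> U then Some (elem_of (entries d ! index_of xs (Var u))) else None)"

section \<open>Reading assignments off a solution of the power\<close>

locale pow_solution = pcsp_data \<Sigma> \<A> I + nondegenerate_minion \<R>
  for \<Sigma> :: "'s signature" and \<A> :: "('s, 'a) rel_struct" and I :: "('s, 'v) pcsp_inst"
    and \<R> :: "(('v, 'a) val, 'r) minion" +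
  fixes k :: nat and r :: "'v lc_var list \<Rightarrow> 'r"
  assumes solution_r: "solution \<R> (sat_pow (k + 1) (lc_of \<A> I)) r"
begin

abbreviation "L \<equiv> lc_of \<A> I"

definition pow_var :: "'v lc_var list \<Rightarrow> bool" where
  "pow_var xs \<longleftrightarrow> length xs = k + 1 \<and> set xs \<subseteq> lvars L"

text \<open>No constraint of the instance is imposed yet: the entries of a power tuple vary
  independently, so a reading need not be a partial solution.\<close>

definition assignments :: "'v set \<Rightarrow> ('v, 'a) val set" where
  "assignments U = Asg ` {f. dom f = U \<and> ran f \<subseteq> carrier \<A>}"

text \<open>The element called r in the overview.\<close>

definition pushed_read :: "'v set \<Rightarrow> 'v lc_var list \<Rightarrow> 'r" where
  "pushed_read U xs = push \<R> (pow_dom L xs) (assignments U) (read U xs) (r xs)"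

lemma finite_assignments: "finite U \<Longrightarrow> finite (assignments U)"
  unfolding assignments_def by (intro finite_imageI finite_set_of_finite_maps finite_carrier)

lemma finite_pow_var: "pow_var xs \<Longrightarrow> finite (pow_dom L xs)"
  unfolding pow_var_def by (simp add: finite_pow_dom_lc_of)

lemma r_in: "pow_var xs \<Longrightarrow> r xs \<in> Obj \<R> (pow_dom L xs)"
  using solution_r unfolding solution_def sat_pow_def pow_var_def by simp

lemma solution_r_constraint:
  assumes "(x, \<alpha>, y) \<in> lcons (sat_pow (k + 1) L)"
  shows "r x = Mor \<R> (pow_dom L y) (pow_dom L x) \<alpha> (r y)"
proof -
  have "\<forall>(x, \<alpha>, y) \<in> lcons (sat_pow (k + 1) L). r x = Mor \<R> (pow_dom L y) (pow_dom L x) \<alpha> (r y)"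
    using solution_r unfolding solution_def by (simp add: sat_pow_def)
  from bspec[OF this assms] show ?thesis by simp
qed

lemma r_constraints:
  assumes "length cs = k + 1" "set cs \<subseteq> add_ids L"
  shows "r (map (\<lambda>(x, \<alpha>, y). x) cs)
      = push \<R> (pow_dom L (map (\<lambda>(x, \<alpha>, y). y) cs)) (pow_dom L (map (\<lambda>(x, \<alpha>, y). x) cs))
         (\<lambda>d. Tup (map2 (\<lambda>(x, \<alpha>, y) e. \<alpha> e) cs (entries d))) (r (map (\<lambda>(x, \<alpha>, y). y) cs))"
  unfolding push_def
  by (rule solution_r_constraint) (unfold sat_pow_def lc.simps, use assms in blast)

lemma r_reindex:
  assumes "pow_var xs" "\<And>i. i < k + 1 \<Longrightarrow> \<sigma> i < k + 1"
  shows "r (map (\<lambda>i. xs ! \<sigma> i) [0..<k + 1])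
      = push \<R> (pow_dom L xs) (pow_dom L (map (\<lambda>i. xs ! \<sigma> i) [0..<k + 1]))
         (\<lambda>d. Tup (map (\<lambda>i. entries d ! \<sigma> i) [0..<k + 1])) (r xs)"
proof -
  \<comment> \<open>Reindexing constraints range over extensional maps; cutting
    \<open>\<sigma>\<close> down to the index range changes none of the lists.\<close>
  define \<tau> where "\<tau> = restrict \<sigma> {..<k + 1}"
  have \<tau>: "\<tau> \<in> {..<k + 1} \<rightarrow>\<^sub>E {..<k + 1}" using assms(2) by (auto simp: \<tau>_def)
  have eq: "map (\<lambda>i. ds ! \<tau> i) [0..<k + 1] = map (\<lambda>i. ds ! \<sigma> i) [0..<k + 1]" for ds :: "'x list"
    by (rule map_cong) (auto simp: \<tau>_def)
  have "r (map (\<lambda>i. xs ! \<tau> i) [0..<k + 1])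
      = push \<R> (pow_dom L xs) (pow_dom L (map (\<lambda>i. xs ! \<tau> i) [0..<k + 1]))
         (\<lambda>d. Tup (map (\<lambda>i. entries d ! \<tau> i) [0..<k + 1])) (r xs)"
    unfolding push_def
    by (rule solution_r_constraint) (unfold sat_pow_def lc.simps, use assms(1) \<tau> in \<open>unfold pow_var_def, blast\<close>)
  then show ?thesis unfolding eq .
qed

lemma reindex_in:
  assumes "pow_var xs" "\<And>i. i < k + 1 \<Longrightarrow> \<sigma> i < k + 1"
  shows "(\<lambda>d. Tup (map (\<lambda>i. entries d ! \<sigma> i) [0..<k + 1]))
    \<in> pow_dom L xs \<rightarrow> pow_dom L (map (\<lambda>i. xs ! \<sigma> i) [0..<k + 1])"
  using assms by (auto simp: mem_pow_dom_iff pow_var_def simp del: upt_Suc)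

lemma entry_Var:
  assumes "d \<in> pow_dom L xs" "Var u \<in> set xs"
  obtains a where "a \<in> carrier \<A>" "entries d ! index_of xs (Var u) = Elem a"
proof -
  obtain ds where ds: "d = Tup ds" "\<forall>i<length xs. ds ! i \<in> ldom L (xs ! i)"
    using assms(1) unfolding mem_pow_dom_iff by blast
  have "ds ! index_of xs (Var u) \<in> ldom L (Var u)"
    using ds(2) index_of[OF assms(2)] by metis
  then show ?thesis using that ds(1) by (auto simp: lc_of_def)
qed

lemma read_in:
  assumes "Var ` U \<subseteq> set xs"
  shows "read U xs \<in> pow_dom L xs \<rightarrow> assignments U"
proof
  fix d assume d: "d \<in> pow_dom L xs"
  have "elem_of (entries d ! index_of xs (Var u)) \<in> carrier \<A>" if "u \<in> U" for u
    using entry_Var[OF d, of u] assms that by (metis elem_of.simps image_subset_iff)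
  then show "read U xs d \<in> assignments U"
    unfolding read_def assignments_def
    by (intro imageI CollectI conjI) (auto simp: dom_def ran_def split: if_splits)
qed

lemma pushed_read_in:
  assumes "pow_var xs" "finite U" "Var ` U \<subseteq> set xs"
  shows "pushed_read U xs \<in> Obj \<R> (assignments U)"
  unfolding pushed_read_def
  by (rule push_in[OF finite_pow_var[OF assms(1)] finite_assignments[OF assms(2)] read_in[OF assms(3)] r_in[OF assms(1)]])

text \<open>Every entry of ys occurs in xs, so ys is a reindexing of xs and a constraint of kind (2)
  carries r at xs to r at ys. The entries read for U are kept.\<close>

lemma pushed_read_eq_of_subset:
  assumes xs: "pow_var xs" and ys: "pow_var ys" and sub: "set ys \<subseteq> set xs"
    and U: "finite U" "Var ` U \<subseteq> set ys"
  shows "pushed_read U ys = pushed_read U xs"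
proof -
  define \<sigma> where "\<sigma> i = index_of xs (ys ! i)" for i
  have len: "length xs = k + 1" "length ys = k + 1" using xs ys unfolding pow_var_def by auto
  have mem: "ys ! i \<in> set xs" if "i < k + 1" for i using sub nth_mem[of i ys] that len by auto
  have \<sigma>: "\<sigma> i < k + 1" "xs ! \<sigma> i = ys ! i" if "i < k + 1" for i
    using index_of[OF mem[OF that]] len unfolding \<sigma>_def by simp_all
  have ys_eq: "map (\<lambda>i. xs ! \<sigma> i) [0..<k + 1] = ys"
    by (rule nth_equalityI) (simp_all add: len \<sigma> del: upt_Suc)
  let ?f = "\<lambda>d :: ('v, 'a) val. Tup (map (\<lambda>i. entries d ! \<sigma> i) [0..<k + 1]) :: ('v, 'a) val"
  have "pushed_read U ys = push \<R> (pow_dom L ys) (assignments U) (read U ys) (push \<R> (pow_dom L xs) (pow_dom L ys) ?f (r xs))"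
    unfolding pushed_read_def using r_reindex[of xs \<sigma>, OF xs \<sigma>(1)] unfolding ys_eq by (rule arg_cong)
  also have "\<dots> = push \<R> (pow_dom L xs) (assignments U) (\<lambda>d. read U ys (?f d)) (r xs)"
    using reindex_in[of xs \<sigma>, OF xs \<sigma>(1)] unfolding ys_eq
    by (intro push_push finite_pow_var finite_assignments read_in xs ys U r_in)
  also have "\<dots> = pushed_read U xs"
    unfolding pushed_read_def
  proof (rule push_cong)
    fix d
    have "?f d = Tup (map (\<lambda>i. entries d ! \<sigma> i) [0..<k + 1])" by simp
    \<comment> \<open>As \<open>\<sigma>\<close> is defined by \<open>index_of xs\<close>, it sends
      the position selected for u in ys to the one selected in xs; repeated entries cause no
      ambiguity.\<close>
    moreover have "map (\<lambda>i. entries d ! \<sigma> i) [0..<k + 1] ! index_of ys (Var u) = entries d ! index_of xs (Var u)"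
      if "u \<in> U" for u
    proof -
      have "index_of ys (Var u) < k + 1" "ys ! index_of ys (Var u) = Var u"
        using index_of[of "Var u" ys] U(2) that len by auto
      then show ?thesis by (simp add: \<sigma>_def del: upt_Suc)
    qed
    ultimately show "read U ys (?f d) = read U xs d"
      unfolding read_def by (auto simp del: upt_Suc)
  qed
  finally show ?thesis .
qed

lemma restrict_assignment_in:
  assumes "U \<subseteq> V"
  shows "(\<lambda>d. Asg (asg d |` U)) \<in> assignments V \<rightarrow> assignments U"
proof
  fix d assume "d \<in> assignments V"
  then obtain f where f: "d = Asg f" "dom f = V" "ran f \<subseteq> carrier \<A>" unfolding assignments_def by blast
  have "dom (f |` U) = U" using f assms by auto
  moreover have "ran (f |` U) \<subseteq> carrier \<A>"
    using f(3) by (auto simp: ran_def restrict_map_def split: if_splits)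
  ultimately show "Asg (asg d |` U) \<in> assignments U" unfolding assignments_def f(1) by simp
qed

lemma pushed_read_restrict:
  assumes xs: "pow_var xs" and V: "finite V" "Var ` V \<subseteq> set xs" and "U \<subseteq> V"
  shows "push \<R> (assignments V) (assignments U) (\<lambda>d. Asg (asg d |` U)) (pushed_read V xs) = pushed_read U xs"
proof -
  have fU: "finite U" by (rule finite_subset[OF \<open>U \<subseteq> V\<close> V(1)])
  have "push \<R> (assignments V) (assignments U) (\<lambda>d. Asg (asg d |` U)) (pushed_read V xs)
      = push \<R> (pow_dom L xs) (assignments U) (\<lambda>d. Asg (asg (read V xs d) |` U)) (r xs)"
    unfolding pushed_read_def
    by (intro push_push finite_pow_var finite_assignments read_in restrict_assignment_in xs V fU r_in assms(4))
  also have "\<dots> = pushed_read U xs"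
    unfolding pushed_read_def
    by (rule push_cong) (use assms(4) in \<open>auto simp: read_def restrict_map_def fun_eq_iff\<close>)
  finally show ?thesis .
qed

section \<open>Supports cut out by single constraints\<close>

definition satisfying :: "nat \<Rightarrow> 'v set \<Rightarrow> ('v, 'a) val set" where
  "satisfying j U = {d \<in> assignments U. map (\<lambda>x. the (asg d x)) (scope_list j) \<in> rel \<A> (fst (I ! j))}"

text \<open>Copying the entry at \<open>CVar j\<close> over the entries at u is a reindexing, and
  projecting the copies is a constraint of kind (1). The composite maps the domain at ys to itself,
  fixes r at ys and has range in the set shown.\<close>

lemma supported_agreeing:
  assumes ys: "pow_var ys" and j: "j < length I" "CVar j \<in> set ys"
    and i: "i < length (scope_list j)" "Var (scope_list j ! i) \<in> set ys"
  shows "supported \<R> (pow_dom L ys) (r ys)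
    {d \<in> pow_dom L ys. entries d ! index_of ys (Var (scope_list j ! i))
       = Elem (elem_of (entries (entries d ! index_of ys (CVar j)) ! i))}"
    (is "supported _ _ _ ?T")
proof -
  define u where "u = Var (scope_list j ! i)"
  define p where "p = index_of ys (CVar j)"
  \<comment> \<open>All occurrences of u are overwritten, whichever of them \<open>index_of\<close>
    selects.\<close>
  define \<sigma> where "\<sigma> m = (if ys ! m = u then p else m)" for m
  define \<pi> where "\<pi> = (\<lambda>d \<in> lc_of_dom \<A> I (CVar j). entries d ! i)"
  \<comment> \<open>The projection at u and the added identity elsewhere lead from zs back to
    ys.\<close>
  define c where "c x = (if x = u then (u, \<pi>, CVar j) else (x, \<lambda>d \<in> ldom L x. d, x))" for x
  define zs where "zs = map (\<lambda>m. ys ! \<sigma> m) [0..<k + 1]"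
  have len: "length ys = k + 1" using ys unfolding pow_var_def by simp
  have p: "p < k + 1" "ys ! p = CVar j" using index_of[OF j(2)] len unfolding p_def by simp_all
  have \<sigma>: "\<sigma> m < k + 1" if "m < k + 1" for m using p that by (simp add: \<sigma>_def)
  have snd_c: "map (\<lambda>(x, \<alpha>, y). y) (map c ys) = zs"
    unfolding zs_def by (rule nth_equalityI) (auto simp: len c_def \<sigma>_def p simp del: upt_Suc)
  have fst_c: "map (\<lambda>(x, \<alpha>, y). x) (map c ys) = ys"
    by (rule nth_equalityI) (auto simp: c_def)
  have cs: "set (map c ys) \<subseteq> add_ids L"
  proof
    fix e assume "e \<in> set (map c ys)"
    then obtain x where x: "x \<in> set ys" "e = c x" by auto
    show "e \<in> add_ids L"
    proof (cases "x = u")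
      case True
      have "(u, \<pi>, CVar j) \<in> lcons L"
        unfolding lc_of_def u_def \<pi>_def using j(1) i(1) by auto
      then show ?thesis using True x by (simp add: c_def add_ids_def)
    next
      case False
      then show ?thesis using x ys unfolding pow_var_def by (auto simp: c_def add_ids_def)
    qed
  qed
  have "set zs \<subseteq> lvars L"
  proof
    fix y assume "y \<in> set zs"
    then obtain e where "e \<in> set (map c ys)" "y = snd (snd e)"
      unfolding snd_c[symmetric] split_beta by (auto simp del: map_map)
    then have "(fst e, fst (snd e), y) \<in> set (map c ys)" by (simp only: prod.collapse)
    then show "y \<in> lvars L" by (rule add_ids_props(2)[OF subsetD[OF cs]])
  qed
  then have zs: "pow_var zs" by (simp add: pow_var_def zs_def)
  let ?f = "\<lambda>d :: ('v, 'a) val. Tup (map (\<lambda>m. entries d ! \<sigma> m) [0..<k + 1]) :: ('v, 'a) val"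
  let ?g = "\<lambda>d :: ('v, 'a) val. Tup (map2 (\<lambda>(x, \<alpha>, y) e. \<alpha> e) (map c ys) (entries d)) :: ('v, 'a) val"
  have f: "?f \<in> pow_dom L ys \<rightarrow> pow_dom L zs"
    using reindex_in[of ys \<sigma>, OF ys \<sigma>] unfolding zs_def .
  have g: "?g \<in> pow_dom L zs \<rightarrow> pow_dom L ys"
    using map_constraints_in[OF cs] unfolding fst_c snd_c .
  have "r ys = push \<R> (pow_dom L zs) (pow_dom L ys) ?g (r zs)"
    using r_constraints[OF _ cs] unfolding fst_c snd_c by (simp add: len)
  also have "r zs = push \<R> (pow_dom L ys) (pow_dom L zs) ?f (r ys)"
    using r_reindex[of ys \<sigma>, OF ys \<sigma>] unfolding zs_def .
  also have "push \<R> (pow_dom L zs) (pow_dom L ys) ?g (push \<R> (pow_dom L ys) (pow_dom L zs) ?f (r ys))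
      = push \<R> (pow_dom L ys) (pow_dom L ys) (\<lambda>d. ?g (?f d)) (r ys)"
    by (rule push_push[OF finite_pow_var[OF ys] finite_pow_var[OF zs] finite_pow_var[OF ys] f g r_in[OF ys]])
  finally have fixed: "r ys = push \<R> (pow_dom L ys) (pow_dom L ys) (\<lambda>d. ?g (?f d)) (r ys)" .
  have "?g (?f d) \<in> ?T" if d: "d \<in> pow_dom L ys" for d
  proof -
    have in_ys: "?g (?f d) \<in> pow_dom L ys" using f g d by (blast dest: funcset_mem)
    obtain ds where ds: "d = Tup ds" "length ds = length ys" "\<forall>i<length ys. ds ! i \<in> ldom L (ys ! i)"
      using d unfolding mem_pow_dom_iff by blast
    have dp: "ds ! p \<in> lc_of_dom \<A> I (CVar j)" using ds(3) p len by (auto simp: lc_of_def)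
    then obtain as where as: "as \<in> rel \<A> (fst (I ! j))" "ds ! p = Tup (map Elem as)" by auto
    have nth: "entries (?g (?f d)) ! m = (if ys ! m = u then entries (ds ! p) ! i else ds ! m)"
      if "m < k + 1" for m
      using that dp ds by (auto simp: len c_def \<sigma>_def \<pi>_def simp del: upt_Suc)
    have idx: "index_of ys u < k + 1" "ys ! index_of ys u = u"
      using index_of[OF i(2)] len unfolding u_def by simp_all
    \<comment> \<open>The entry at p survives because \<open>CVar j\<close> differs from u, so the
      new entry at u agrees with the entry at p of the new tuple.\<close>
    have "entries (?g (?f d)) ! p = ds ! p" using nth[OF p(1)] p(2) by (simp add: u_def)
    moreover have "entries (?g (?f d)) ! index_of ys u = entries (ds ! p) ! i"
      using nth[OF idx(1)] idx(2) by simp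
    moreover have "entries (ds ! p) ! i = Elem (elem_of (entries (ds ! p) ! i))"
      using as i(1) rel_props(1)[OF j(1) as(1)] by simp
    ultimately show ?thesis
      using in_ys unfolding u_def[symmetric] p_def[symmetric] by (simp only: mem_Collect_eq)
  qed
  then have "(\<lambda>d. ?g (?f d)) ` pow_dom L ys \<subseteq> ?T" by blast
  from supported_range[OF finite_pow_var[OF ys] finite_pow_var[OF ys] r_in[OF ys] this]
  show ?thesis unfolding fixed[symmetric] by blast
qed

text \<open>The tuple xs need not contain \<open>CVar j\<close>, so the reading is moved to a tuple
  ys that does. There the supports from \<open>supported_agreeing\<close>, one per entry of the
  scope, intersect in tuples whose reading satisfies the constraint.\<close>

lemma supported_satisfying:
  assumes xs: "pow_var xs" and U: "finite U" "card U \<le> k" "U \<subseteq> inst_vars I" "Var ` U \<subseteq> set xs"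
    and j: "j < length I" and scope: "set (scope_list j) \<subseteq> U"
  shows "supported \<R> (assignments U) (pushed_read U xs) (satisfying j U)"
proof (cases "U = {}")
  case True
  let ?ys = "replicate (k + 1) (CVar j)"
  have "pow_var ?ys" using j unfolding pow_var_def by (auto simp: lc_of_def)
  then have "pow_dom L ?ys \<noteq> {}" using r_in[of ?ys] Obj_empty by auto
  then obtain ds where "\<forall>i<k + 1. ds ! i \<in> ldom L (?ys ! i)"
    unfolding ex_in_conv[symmetric] mem_pow_dom_iff length_replicate by blast
  from this[rule_format, of 0] have "ds ! 0 \<in> lc_of_dom \<A> I (CVar j)" by (simp add: lc_of_def)
  then obtain as where as: "as \<in> rel \<A> (fst (I ! j))" by auto
  have "scope_list j = []" using scope True by simp
  then have "[] \<in> rel \<A> (fst (I ! j))" using rel_props(1)[OF j as] as by simp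
  then have "satisfying j U = assignments U"
    using \<open>scope_list j = []\<close> unfolding satisfying_def by simp
  then show ?thesis
    using supported_self[OF finite_assignments[OF U(1)] pushed_read_in[OF xs U(1,4)]] by simp
next
  case False
  have sub: "Var ` U \<subseteq> lvars L" using U(3) by (auto simp: lc_of_def)
  have card: "card (Var ` U) \<le> k" using U(1,2) card_image_le le_trans by blast
  \<comment> \<open>The entries of xs and ys may be incomparable, but both include those of us, so
    two comparisons link their readings.\<close>
  obtain us where us: "set us = Var ` U" "length us = k + 1"
    using obtain_list_of_length[of "Var ` U" "k + 1"] False U(1) card by auto
  \<comment> \<open>At most k variables together with \<open>CVar j\<close> fit into k + 1 entries;
    this is the use of the larger exponent.\<close>
  obtain ys where ys: "set ys = insert (CVar j) (Var ` U)" "length ys = k + 1"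
  proof (rule obtain_list_of_length[of "insert (CVar j) (Var ` U)" "k + 1"])
    show "card (insert (CVar j) (Var ` U)) \<le> k + 1"
      using card card_insert_le_m1[of "k + 1" "Var ` U" "CVar j"] by simp
  qed (use U(1) in auto)
  have pus: "pow_var us" using us sub unfolding pow_var_def by simp
  have pys: "pow_var ys" using ys sub j unfolding pow_var_def by (auto simp: lc_of_def)
  have "pushed_read U xs = pushed_read U us" using pushed_read_eq_of_subset[OF xs pus _ U(1)] us(1) U(4) by simp
  also have "\<dots> = pushed_read U ys" using pushed_read_eq_of_subset[OF pys pus _ U(1)] us(1) ys(1) by auto
  finally have q: "pushed_read U xs = push \<R> (pow_dom L ys) (assignments U) (read U ys) (r ys)"
    by (simp only: pushed_read_def)
  let ?T = "\<lambda>i. {d \<in> pow_dom L ys. entries d ! index_of ys (Var (scope_list j ! i))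
       = Elem (elem_of (entries (entries d ! index_of ys (CVar j)) ! i))}"
  have mem: "Var (scope_list j ! i) \<in> set ys" if "i < length (scope_list j)" for i
    using ys(1) scope nth_mem[OF that] by auto
  have T: "supported \<R> (pow_dom L ys) (r ys) (pow_dom L ys \<inter> (\<Inter>i\<in>{..<length (scope_list j)}. ?T i))"
  proof (rule supported_INT[OF finite_pow_var[OF pys] r_in[OF pys]])
    show "supported \<R> (pow_dom L ys) (r ys) (?T i)" if "i \<in> {..<length (scope_list j)}" for i
      using supported_agreeing[OF pys j _ _ mem] ys(1) that by simp
  qed simp
  have Var_ys: "Var ` U \<subseteq> set ys" using ys(1) by auto
  show ?thesis unfolding q
  proof (rule supported_push[OF finite_pow_var[OF pys] finite_assignments[OF U(1)] T read_in[OF Var_ys]])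
    show "read U ys ` (pow_dom L ys \<inter> (\<Inter>i\<in>{..<length (scope_list j)}. ?T i)) \<subseteq> satisfying j U"
    proof (rule image_subsetI)
      fix d assume dT: "d \<in> pow_dom L ys \<inter> (\<Inter>i\<in>{..<length (scope_list j)}. ?T i)"
      then have d: "d \<in> pow_dom L ys" by simp
      let ?p = "index_of ys (CVar j)"
      have p: "?p < length ys" "ys ! ?p = CVar j" using index_of[of "CVar j" ys] ys(1) by simp_all
      have "entries d ! ?p \<in> ldom L (ys ! ?p)"
        using d p(1) by (auto simp: mem_pow_dom_iff)
      then obtain as where as: "as \<in> rel \<A> (fst (I ! j))" "entries d ! ?p = Tup (map Elem as)"
        unfolding p(2) by (auto simp: lc_of_def)
      have len: "length as = length (scope_list j)" by (rule rel_props(1)[OF j as(1)])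
      \<comment> \<open>Agreement at every i makes the assignment along the scope equal to the tuple
        stored at \<open>CVar j\<close>, a member of the relation.\<close>
      have "map (\<lambda>x. the (asg (read U ys d) x)) (scope_list j) = as"
      proof (rule nth_equalityI)
        fix i assume "i < length (map (\<lambda>x. the (asg (read U ys d) x)) (scope_list j))"
        then have i: "i < length (scope_list j)" by simp
        then have "d \<in> ?T i" using dT by blast
        then have "entries d ! index_of ys (Var (scope_list j ! i)) = Elem (as ! i)"
          using as(2) i len by simp
        then show "map (\<lambda>x. the (asg (read U ys d) x)) (scope_list j) ! i = as ! i"
          using i subsetD[OF scope nth_mem[OF i]] by (simp add: read_def)
      qed (simp add: len)
      then show "read U ys d \<in> satisfying j U"
        using as(1) funcset_mem[OF read_in[OF Var_ys] d] unfolding satisfying_def by simp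
    qed
  qed (auto simp: satisfying_def)
qed

text \<open>One condition per constraint inside U, in the shape that \<open>supported_INT\<close>
  produces.\<close>

lemma lc_upto_dom_eq:
  "lc_upto_dom \<A> I U =
    assignments U \<inter> (\<Inter>j\<in>{j. j < length I \<and> set (scope_list j) \<subseteq> U}. satisfying j U)"
  (is "_ = ?R")
proof
  show "lc_upto_dom \<A> I U \<subseteq> ?R"
  proof
    fix d assume "d \<in> lc_upto_dom \<A> I U"
    then obtain f where f: "d = Asg f" "f \<in> partial_solutions \<A> I U" by (auto simp: lc_upto_dom_def)
    have "d \<in> assignments U" using f unfolding assignments_def partial_solutions_def by blast
    then show "d \<in> ?R"
      using partial_solution_constraint[OF f(2) constraint_props(3)] by (simp add: satisfying_def f(1))
  qed
  show "?R \<subseteq> lc_upto_dom \<A> I U"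
  proof
    fix d assume d: "d \<in> ?R"
    then obtain f where f: "d = Asg f" "dom f = U" "ran f \<subseteq> carrier \<A>"
      by (auto simp: assignments_def)
    have "map (\<lambda>x. the (f x)) xs \<in> rel \<A> R" if c: "(R, xs) \<in> set I" "set xs \<subseteq> U" for R xs
    proof -
      obtain j where j: "j < length I" "I ! j = (R, xs)" using c(1) by (auto simp: in_set_conv_nth)
      then have "d \<in> satisfying j U" using d c(2) by auto
      then show ?thesis using j by (simp add: satisfying_def f(1))
    qed
    then have "f \<in> partial_solutions \<A> I U" using f unfolding partial_solutions_def by blast
    then show "d \<in> lc_upto_dom \<A> I U" by (simp add: f(1) lc_upto_dom_def)
  qed
qed

lemma supported_partial_solutions:
  assumes xs: "pow_var xs" and U: "finite U" "card U \<le> k" "U \<subseteq> inst_vars I" "Var ` U \<subseteq> set xs"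
  shows "supported \<R> (assignments U) (pushed_read U xs) (lc_upto_dom \<A> I U)"
  unfolding lc_upto_dom_eq
  by (rule supported_INT[OF finite_assignments[OF U(1)] pushed_read_in[OF xs U(1,4)]])
    (use supported_satisfying[OF xs U] in auto)

text \<open>
  The common extra entry \<open>CVar 0\<close> makes the tuple chosen for \<open>U\<close> a reindexing of the one
  chosen for any superset of \<open>U\<close>, even if \<open>U\<close> is empty.
\<close>

theorem has_solution_lc_upto:
  assumes "I \<noteq> []"
  shows "has_solution \<R> (lc_upto k \<A> I)"
proof -
  have ex_list: "\<exists>xs. set xs = insert (CVar 0) (Var ` U) \<and> length xs = k + 1" if "finite U" "card U \<le> k" for U :: "'v set"
  proof -
    have "card (Var ` U) \<le> k" using that card_image_le le_trans by blast
    then have "card (insert (CVar 0) (Var ` U)) \<le> k + 1"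
      using card_insert_le_m1[of "k + 1" "Var ` U" "CVar 0"] by simp
    with \<open>finite U\<close> obtain xs where "set xs = insert (CVar 0) (Var ` U)" "length xs = k + 1"
      by (auto intro: obtain_list_of_length[of "insert (CVar 0) (Var ` U)" "k + 1"])
    then show ?thesis by blast
  qed
  define b where "b U = (SOME xs. set xs = insert (CVar 0) (Var ` U) \<and> length xs = k + 1)" for U :: "'v set"
  have b: "set (b U) = insert (CVar 0) (Var ` U) \<and> length (b U) = k + 1" if "finite U" "card U \<le> k" for U
    unfolding b_def by (rule someI_ex[OF ex_list[OF that]])
  let ?P = "lc_upto_dom \<A> I"
  define small where "small U \<longleftrightarrow> U \<subseteq> inst_vars I \<and> card U \<le> k" for U
  have fin: "finite U" if "small U" for U
    using that finite_inst_vars finite_subset unfolding small_def by blast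
  have b_set: "set (b U) = insert (CVar 0) (Var ` U)" if "small U" for U
    using b[OF fin[OF that]] that unfolding small_def by simp
  \<comment> \<open>\<open>CVar 0\<close> is available because I is nonempty.\<close>
  have pb: "pow_var (b U)" if "small U" for U
    using b[OF fin[OF that]] that assms unfolding small_def pow_var_def by (auto simp: lc_of_def)
  have ex_s: "\<exists>s. s \<in> Obj \<R> (?P U) \<and> pushed_read U (b U) = push \<R> (?P U) (assignments U) (\<lambda>d. d) s" if "small U" for U
    using supported_partial_solutions[OF pb[OF that] fin[OF that]] that b_set[OF that]
    unfolding supported_def small_def by blast
  define s where "s U = (SOME s. s \<in> Obj \<R> (?P U) \<and> pushed_read U (b U) = push \<R> (?P U) (assignments U) (\<lambda>d. d) s)" for U
  have s: "s U \<in> Obj \<R> (?P U)" "pushed_read U (b U) = push \<R> (?P U) (assignments U) (\<lambda>d. d) (s U)" if "small U" for U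
    using someI_ex[OF ex_s[OF that]] unfolding s_def by blast+
  have "s U = push \<R> (?P V) (?P U) (\<lambda>d. Asg (asg d |` U)) (s V)" if sub: "U \<subseteq> V" and V: "small V" for U V
  proof -
    let ?res = "\<lambda>d :: ('v, 'a) val. Asg (asg d |` U) :: ('v, 'a) val"
    have U: "small U"
      using sub V card_mono[OF fin[OF V] sub] unfolding small_def by auto
    note fins = finite_assignments[OF fin[OF U]] finite_assignments[OF fin[OF V]]
    have PU: "?P U \<subseteq> assignments U" and PV: "?P V \<subseteq> assignments V" unfolding lc_upto_dom_eq by auto
    note finP = finite_subset[OF PU fins(1)] finite_subset[OF PV fins(2)]
    have res: "?res \<in> ?P V \<rightarrow> ?P U" using restrict_asg_in[OF sub] by blast
    \<comment> \<open>The two candidates at U are compared after inclusion into all assignments,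
      where both equal the reading on U; the inclusion is injective on elements.\<close>
    have "push \<R> (?P U) (assignments U) (\<lambda>d. d) (push \<R> (?P V) (?P U) ?res (s V))
        = push \<R> (?P V) (assignments U) ?res (s V)"
      by (rule push_push[OF finP(2,1) fins(1) res _ s(1)[OF V]]) (use PU in auto)
    also have "\<dots> = push \<R> (assignments V) (assignments U) ?res (pushed_read V (b V))"
      unfolding s(2)[OF V]
      by (rule push_inclusion[OF fins(2,1) PV restrict_assignment_in[OF sub] s(1)[OF V], symmetric])
    also have "\<dots> = pushed_read U (b V)"
      using b_set[OF V] by (intro pushed_read_restrict[OF pb[OF V] fin[OF V] _ sub]) auto
    also have "\<dots> = pushed_read U (b U)"
      using b_set[OF V] b_set[OF U] sub
      by (intro pushed_read_eq_of_subset[OF pb[OF V] pb[OF U] _ fin[OF U], symmetric]) auto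
    also have "\<dots> = push \<R> (?P U) (assignments U) (\<lambda>d. d) (s U)" by (rule s(2)[OF U])
    finally show ?thesis
      using push_inclusion_inject[OF fins(1) PU s(1)[OF U] push_in[OF finP(2,1) res s(1)[OF V]]] by simp
  qed
  then have "solution \<R> (lc_upto k \<A> I) s"
    using s(1) unfolding solution_def lc_upto_def push_def small_def by auto
  then show ?thesis unfolding has_solution_def by blast
qed

end

section \<open>The empty instance and the final theorem\<close>

text \<open>Without constraints the power of exponent k + 1 has no variables and gives no
  information, while the bounded instance still has the variable \<open>{}\<close> with a one-point
  domain. Any element of the minion can be pushed there.\<close>

lemma has_solution_lc_upto_Nil:
  assumes "is_minion \<R>" "finite D" "p \<in> Obj \<R> D"
  shows "has_solution \<R> (lc_upto k \<A> [])"
proof -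
  interpret minion \<R> by (rule minion.intro) fact
  have vars: "inst_vars [] = {}" by (simp add: inst_vars_def)
  have dom: "lc_upto_dom \<A> [] {} = {Asg Map.empty}"
    by (auto simp: lc_upto_dom_def partial_solutions_def)
  define c where "c = push \<R> D {Asg Map.empty} (\<lambda>_. Asg Map.empty) p"
  have c: "c \<in> Obj \<R> {Asg Map.empty}"
    unfolding c_def using assms by (intro push_in) auto
  have "c = push \<R> {Asg Map.empty} {Asg Map.empty} (\<lambda>d. Asg (asg d |` {})) c"
    by (rule push_id[OF _ c, symmetric]) auto
  then have "solution \<R> (lc_upto k \<A> []) (\<lambda>_. c)"
    using c unfolding solution_def lc_upto_def push_def by (auto simp: vars dom)
  then show ?thesis unfolding has_solution_def by blast
qed

text \<open>The extra conditions in the second implication exclude real failures. The minion with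
  one element at each nonempty set and none at the empty set solves all instances with nonempty
  domains, but not \<open>lc_upto 3\<close> for 2-colouring a triangle. The minion without elements
  solves the power of the empty instance vacuously, but not its bounded instance.\<close>

theorem theorem6p7:
  fixes \<Sigma> :: "'s signature"
    and \<A> :: "('s, 'a) rel_struct" and \<B> :: "('s, 'b) rel_struct"
    and \<R> :: "(('v, 'a) val, 'r) minion"
    and I :: "('s, 'v) pcsp_inst"
    and k :: nat
  assumes "pcsp_template \<Sigma> \<A> \<B>"
    and "is_minion \<R>"
    and "\<not> (\<forall>\<D> :: ('w, ('v, 'a) val) lc. lc_instance \<D> \<longrightarrow> has_solution \<R> \<D>)"
    and "is_instance \<Sigma> I"
  shows "(has_solution \<R> (lc_upto (max_arity \<Sigma> * k) \<A> I) \<longrightarrow> has_solution \<R> (sat_pow k (lc_of \<A> I)))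
       \<and> (\<not> (\<forall>\<D> :: ('w, ('v, 'a) val) lc.
                lc_instance \<D> \<and> (\<forall>x \<in> lvars \<D>. ldom \<D> x \<noteq> {}) \<longrightarrow> has_solution \<R> \<D>) \<longrightarrow>
          (I \<noteq> [] \<or> (\<exists>D. finite D \<and> Obj \<R> D \<noteq> {})) \<longrightarrow>
          has_solution \<R> (sat_pow (k + 1) (lc_of \<A> I)) \<longrightarrow> has_solution \<R> (lc_upto k \<A> I))"
proof (intro conjI impI)
  interpret pcsp_data \<Sigma> \<A> I
    using assms(1,4) unfolding pcsp_template_def by unfold_locales simp_all
  show "has_solution \<R> (sat_pow k (lc_of \<A> I))" if "has_solution \<R> (lc_upto (max_arity \<Sigma> * k) \<A> I)"
    using assms(2) that by (rule has_solution_sat_pow)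
next
  interpret minion \<R> by (rule minion.intro) fact
  assume nontrivial: "\<not> (\<forall>\<D> :: ('w, ('v, 'a) val) lc.
      lc_instance \<D> \<and> (\<forall>x \<in> lvars \<D>. ldom \<D> x \<noteq> {}) \<longrightarrow> has_solution \<R> \<D>)"
    and nonempty: "I \<noteq> [] \<or> (\<exists>D. finite D \<and> Obj \<R> D \<noteq> {})"
    and pow: "has_solution \<R> (sat_pow (k + 1) (lc_of \<A> I))"
  show "has_solution \<R> (lc_upto k \<A> I)"
  proof (cases "I = []")
    case True
    then show ?thesis using nonempty has_solution_lc_upto_Nil[OF assms(2)] by blast
  next
    case False
    obtain r where "solution \<R> (sat_pow (k + 1) (lc_of \<A> I)) r" using pow unfolding has_solution_def by blast
    moreover have "Obj \<R> {} = {}"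
      using assms(3) has_solution_if_Obj_empty_nonempty by blast
    moreover have "S \<inter> T \<noteq> {}"
      if "finite D" "r \<in> Obj \<R> D" "supported \<R> D r S" "supported \<R> D r T" for D r S T
      using nontrivial has_solution_if_disjoint_supports[OF that] by blast
    ultimately interpret pow_solution \<Sigma> \<A> I \<R> k r
      using assms(1,4) unfolding pcsp_template_def by unfold_locales simp_all
    show ?thesis using False by (rule has_solution_lc_upto)
  qed
qed

end
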